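(* Let $P_n(x)=P_n(x;a,b,c)$, $n\ge 0$, be the monic big q-Jacobi polynomials, and let $\tau_0,\dots,\tau_4\in\mathbb{C}$. Then the big q-Heun operator $W=\tau_1XY+\tau_2YX+\tau_3X+\tau_4Y+\tau_0\mathcal{I}$ is tridiagonal in the basis $\{P_n\}$: for all $n\ge0$, $$W P_n(x)=\xi_{n+1}P_{n+1}(x)+\eta_nP_n(x)+\zeta_n u_n P_{n-1}(x),$$ where $$\xi_n=\tau_1\lambda_{n-1}+\tau_2\lambda_n+\tau_3,\qquad \zeta_n=\tau_2\lambda_{n-1}+\tau_1\lambda_n+\tau_3,\qquad \eta_n=(\tau_1+\tau_2)\lambda_nb_n+\tau_3b_n+\tau_4\lambda_n+\tau_0,$$ with $\lambda_n=(q^{-n}-1)(1-abq^{n+1})$, and $b_n,u_n$ the coefficients of the three-term recurrence relation $xP_n(x)=P_{n+1}(x)+b_nP_n(x)+u_nP_{n-1}(x)$ (with $u_0=0$, $P_{-1}=0$).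
   Context: $q\in\mathbb{C}$ is nonzero and not a root of unity. $T^{+}f(x)=f(qx)$, $T^{-}f(x)=f(x/q)$, and $\mathcal{I}$ is the identity operator. $X$ is multiplication by $x$, and $$Y=B(x)T^{+}+D(x)T^{-}-(B(x)+D(x))\mathcal{I},\quad B(x)=aq\,x^{-2}(x-1)(bx-c),\quad D(x)=x^{-2}(x-aq)(x-cq).$$ The parameters $a,b,c\in\mathbb{C}$ are such that $aq^k\ne1$, $cq^k\neq 1$, $abq^k\ne 1$ for all integers $k\ge1$. The big q-Jacobi polynomial $P_n(x;a,b,c)$ is the monic polynomial of degree $n$ proportional to $${}_3\Phi_2\left({q^{-n},\,abq^{n+1},\,x\atop aq,\,cq};q,q\right)=\sum_{k=0}^n\frac{(q^{-n};q)_k(abq^{n+1};q)_k(x;q)_k}{(aq;q)_k(cq;q)_k(q;q)_k}q^k,$$ with $(y;q)_k=\prod_{j=0}^{k-1}(1-yq^j)$. It is known that $YP_n=\lambda_nP_n$ with $\lambda_n=(q^{-n}-1)(1-abq^{n+1})$ and that the $P_n$ satisfy a three-term recurrence relation $xP_n=P_{n+1}+b_nP_n+u_nP_{n-1}$. *)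

theory Defs
  imports Complex_Main "HOL-Computational_Algebra.Polynomial"
begin

definition qpoch :: "'a::comm_ring_1 \<Rightarrow> 'a \<Rightarrow> nat \<Rightarrow> 'a" where
  "qpoch y q k = (\<Prod>j<k. 1 - y * q ^ j)"

(* The terminating series 3Phi2(q^-n, a b q^(n+1), x; a q, c q; q, q) as a polynomial in x:
   the factor (x;q)_k is the q-shifted factorial in the polynomial ring. *)
definition Phi32 :: "complex \<Rightarrow> complex \<Rightarrow> complex \<Rightarrow> complex \<Rightarrow> nat \<Rightarrow> complex poly" where
  "Phi32 q a b c n =
     (\<Sum>k=0..n. smult (qpoch (q powi (- int n)) q k * qpoch (a * b * q ^ (n + 1)) q k /
                        (qpoch (a * q) q k * qpoch (c * q) q k * qpoch q q k) * q ^ k)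
                      (qpoch [:0, 1:] [:q:] k))"

(* That Phi32 has degree exactly n, so that bqJacobi is monic of degree n for admissible
   parameters, is shown in bqJacobi_monic below. *)
definition bqJacobi :: "complex \<Rightarrow> complex \<Rightarrow> complex \<Rightarrow> complex \<Rightarrow> nat \<Rightarrow> complex poly" where
  "bqJacobi q a b c n = smult (inverse (lead_coeff (Phi32 q a b c n))) (Phi32 q a b c n)"

(* Operators act on functions of x. As the coefficients B and D have a pole at 0,
   values of Y f, and of anything built from it, are meaningful only for x \<noteq> 0. *)
definition Tplus :: "complex \<Rightarrow> (complex \<Rightarrow> complex) \<Rightarrow> complex \<Rightarrow> complex" where
  "Tplus q f = (\<lambda>x. f (q * x))"

definition Tminus :: "complex \<Rightarrow> (complex \<Rightarrow> complex) \<Rightarrow> complex \<Rightarrow> complex" where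
  "Tminus q f = (\<lambda>x. f (x / q))"

definition Xop :: "(complex \<Rightarrow> complex) \<Rightarrow> complex \<Rightarrow> complex" where
  "Xop f = (\<lambda>x. x * f x)"

definition Bcoef :: "complex \<Rightarrow> complex \<Rightarrow> complex \<Rightarrow> complex \<Rightarrow> complex \<Rightarrow> complex" where
  "Bcoef q a b c x = a * q * (x - 1) * (b * x - c) / x ^ 2"

definition Dcoef :: "complex \<Rightarrow> complex \<Rightarrow> complex \<Rightarrow> complex \<Rightarrow> complex" where
  "Dcoef q a c x = (x - a * q) * (x - c * q) / x ^ 2"

definition Yop :: "complex \<Rightarrow> complex \<Rightarrow> complex \<Rightarrow> complex \<Rightarrow>
    (complex \<Rightarrow> complex) \<Rightarrow> complex \<Rightarrow> complex" where
  "Yop q a b c f = (\<lambda>x. Bcoef q a b c x * Tplus q f x + Dcoef q a c x * Tminus q f x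
                          - (Bcoef q a b c x + Dcoef q a c x) * f x)"

definition qHeun :: "complex \<Rightarrow> complex \<Rightarrow> complex \<Rightarrow> complex \<Rightarrow>
    complex \<Rightarrow> complex \<Rightarrow> complex \<Rightarrow> complex \<Rightarrow> complex \<Rightarrow>
    (complex \<Rightarrow> complex) \<Rightarrow> complex \<Rightarrow> complex" where
  "qHeun q a b c \<tau>0 \<tau>1 \<tau>2 \<tau>3 \<tau>4 f =
     (\<lambda>x. \<tau>1 * Xop (Yop q a b c f) x + \<tau>2 * Yop q a b c (Xop f) x
          + \<tau>3 * Xop f x + \<tau>4 * Yop q a b c f x + \<tau>0 * f x)"

(* The index is an integer because the coefficient zeta_0 refers to lambda_(-1). *)
definition eigval :: "complex \<Rightarrow> complex \<Rightarrow> complex \<Rightarrow> int \<Rightarrow> complex" where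
  "eigval q a b n = (q powi (- n) - 1) * (1 - a * b * q powi (n + 1))"

lemma qpoch_nonzero:
  fixes y q :: complex
  assumes "\<And>j. j < k \<Longrightarrow> y * q ^ j \<noteq> 1"
  shows "qpoch y q k \<noteq> 0"
  using assms unfolding qpoch_def by fastforce

lemma degree_qpoch_X:
  fixes q :: complex
  assumes "q \<noteq> 0"
  shows "degree (qpoch [:0, 1:] [:q:] k) = k"
proof -
  have eq: "1 - [:0, 1:] * [:q:] ^ j = [:1, - (q ^ j):]" for j
    by (simp add: poly_const_pow one_pCons)
  show ?thesis
    unfolding qpoch_def eq using assms by (subst degree_prod_eq_sum_degree) auto
qed

lemma bqJacobi_monic:
  fixes q a b c :: complex
  assumes q0: "q \<noteq> 0" and q1: "\<forall>k\<ge>1. q ^ k \<noteq> 1"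
    and a: "\<forall>k\<ge>1. a * q ^ k \<noteq> 1" and c: "\<forall>k\<ge>1. c * q ^ k \<noteq> 1"
    and ab: "\<forall>k\<ge>1. a * b * q ^ k \<noteq> 1"
  shows "degree (bqJacobi q a b c n) = n" and "lead_coeff (bqJacobi q a b c n) = 1"
proof -
  define t where "t k = qpoch (q powi (- int n)) q k * qpoch (a * b * q ^ (n + 1)) q k /
    (qpoch (a * q) q k * qpoch (c * q) q k * qpoch q q k) * q ^ k" for k
  have "qpoch (q powi (- int n)) q n \<noteq> 0"
  proof (rule qpoch_nonzero)
    fix j assume j: "j < n"
    then have "q ^ n = q ^ j * q ^ (n - j)" by (simp flip: power_add)
    moreover have "q ^ (n - j) \<noteq> 1" using q1 j by simp
    ultimately show "q powi (- int n) * q ^ j \<noteq> 1"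
      using q0 by (auto simp: power_int_minus field_simps)
  qed
  moreover have "qpoch (a * b * q ^ (n + 1)) q n \<noteq> 0"
    by (rule qpoch_nonzero) (use ab in \<open>simp add: mult.assoc flip: power_add power_Suc\<close>)
  moreover have "qpoch (a * q) q n \<noteq> 0"
    by (rule qpoch_nonzero) (use a in \<open>auto simp: mult.assoc simp flip: power_Suc\<close>)
  moreover have "qpoch (c * q) q n \<noteq> 0"
    by (rule qpoch_nonzero) (use c in \<open>auto simp: mult.assoc simp flip: power_Suc\<close>)
  moreover have "qpoch q q n \<noteq> 0"
    by (rule qpoch_nonzero) (use q1 in \<open>simp flip: power_Suc\<close>)
  ultimately have tn: "t n \<noteq> 0" using q0 by (simp add: t_def)
  let ?p = "\<lambda>k. smult (t k) (qpoch [:0, 1:] [:q:] k)"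
  have Phi: "Phi32 q a b c n = (\<Sum>k<n. ?p k) + ?p n"
    unfolding Phi32_def t_def atLeast0AtMost lessThan_Suc_atMost[symmetric] by simp
  have deg: "degree (?p n) = n" using tn q0 by (simp add: degree_qpoch_X)
  have dP: "degree (Phi32 q a b c n) = n"
  proof (cases "n = 0")
    case True then show ?thesis using deg Phi by simp
  next
    case False
    have "degree (\<Sum>k<n. ?p k) < n"
      by (rule degree_sum_less) (use False q0 in \<open>auto simp: degree_qpoch_X\<close>)
    then show ?thesis unfolding Phi using deg by (metis degree_add_eq_right)
  qed
  have "coeff (Phi32 q a b c n) n \<noteq> 0"
  proof (cases "n = 0")
    case True then show ?thesis using tn Phi by (simp add: qpoch_def)
  next
    case False then show ?thesis using dP by (metis leading_coeff_0_iff degree_0)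
  qed
  then show "degree (bqJacobi q a b c n) = n" "lead_coeff (bqJacobi q a b c n) = 1"
    using dP by (auto simp: bqJacobi_def)
qed

end

theory Submission
  imports Defs
begin

text \<open>
  Multiplication by \<open>x\<close> is tridiagonal on the \<open>P n\<close> by the three-term recurrence, so once the
  \<open>P n\<close> are known to be eigenfunctions of \<open>Y\<close>, both \<open>X Y\<close> and \<open>Y X\<close> are tridiagonal as well:
  in \<open>X Y (P n)\<close> the recurrence is multiplied by the eigenvalue at \<open>n\<close>, while in \<open>Y X (P n)\<close>
  each of its three terms is multiplied by its own eigenvalue.

  The work lies in the eigenvalue equation. In the basis of shifted factorials
  \<open>\<phi> k = (x;q)_k\<close> the operator \<open>Y\<close> is bidiagonal,
  \<open>Y (\<phi> k) = \<lambda> k * \<phi> k - \<mu> k * \<phi> (k - 1)\<close> where \<open>\<lambda> k\<close> is the eigenvalue and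
  \<open>\<mu> k = q^(-k) (1 - q^k) (1 - a q^k) (1 - c q^k)\<close> (lemma \<open>Yop_qpoch_Suc\<close>): the zeros of \<open>\<phi> k\<close>
  form a geometric progression, so a shift changes only one factor at either end, and the pole
  of \<open>B\<close> and \<open>D\<close> at \<open>x = 0\<close> cancels. Hence the eigenvalue equation for \<open>\<Sum>k. t k * \<phi> k\<close> is
  the first-order recursion \<open>t (k + 1) * \<mu> (k + 1) = t k * (\<lambda> k - \<lambda> n)\<close>. The hypergeometric coefficients satisfy
  it (lemma \<open>phi_coeff_Suc\<close>), so the sum of the first terms telescopes to a multiple of
  \<open>\<lambda> m - \<lambda> n\<close> (lemma \<open>Yop_partial_sum\<close>), which vanishes when the series terminates at \<open>m = n\<close>.
\<close>

lemma qpoch_0 [simp]: "qpoch y q 0 = 1"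
  by (simp add: qpoch_def)

lemma qpoch_Suc: "qpoch y q (Suc k) = qpoch y q k * (1 - y * q ^ k)"
  by (simp add: qpoch_def)

lemma qpoch_Suc_shift: "qpoch y q (Suc k) = (1 - y) * qpoch (q * y) q k"
  unfolding qpoch_def
  by (subst prod.lessThan_Suc_shift) (simp add: mult_ac)

lemma poly_qpoch_X: "poly (qpoch [:0, 1:] [:q:] k) x = qpoch x q k"
  by (simp add: qpoch_def poly_prod poly_power)

lemma eigval_of_nat:
  assumes "q \<noteq> 0"
  shows "eigval q a b (int k) = (1 - q ^ k) * (1 - a * b * q ^ (k + 1)) / q ^ k"
proof -
  have "q powi (int k + 1) = q ^ (k + 1)"
    by (metis of_nat_1 of_nat_add power_int_of_nat)
  then show ?thesis
    using assms by (simp add: eigval_def power_int_minus field_simps)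
qed

lemma Yop_add: "Yop q a b c (\<lambda>x. f x + g x) x = Yop q a b c f x + Yop q a b c g x"
  by (simp add: Yop_def Tplus_def Tminus_def algebra_simps)

lemma Yop_cmult: "Yop q a b c (\<lambda>x. s * f x) x = s * Yop q a b c f x"
  by (simp add: Yop_def Tplus_def Tminus_def algebra_simps)

lemma Yop_const: "Yop q a b c (\<lambda>x. s) x = 0"
  by (simp add: Yop_def Tplus_def Tminus_def algebra_simps)

text \<open>
  The factor \<open>x - 1\<close> of \<open>B\<close> completes \<open>(qx;q)_(k+1)\<close> to \<open>(x;q)_(k+2)\<close>, so that all three terms
  are multiples of \<open>(x;q)_k\<close>. In their sum, the cofactor of \<open>(x;q)_k\<close> collapses to a polynomial of
  degree at most 1 in \<open>x\<close>, which is a combination of \<open>1\<close> and \<open>1 - x q^k\<close>.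
\<close>
lemma Yop_qpoch_Suc:
  assumes q: "q \<noteq> 0" and x: "x \<noteq> 0"
  shows "Yop q a b c (\<lambda>x. qpoch x q (Suc k)) x
    = eigval q a b (int (Suc k)) * qpoch x q (Suc k)
      - (1 - q ^ Suc k) * (1 - a * q ^ Suc k) * (1 - c * q ^ Suc k) / q ^ Suc k * qpoch x q k"
proof -
  define f where "f = qpoch x q k"
  define Q where "Q = q ^ k"
  have Q: "Q \<noteq> 0" using q by (simp add: Q_def)
  have f1: "qpoch x q (Suc k) = f * (1 - x * Q)"
    by (simp add: qpoch_Suc f_def Q_def)
  have "(1 - x) * qpoch (q * x) q (Suc k) = qpoch x q (Suc (Suc k))"
    by (simp only: qpoch_Suc_shift)
  also have "\<dots> = f * (1 - x * Q) * (1 - x * (q * Q))"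
    by (simp add: qpoch_Suc f_def Q_def)
  finally have "Bcoef q a b c x * qpoch (q * x) q (Suc k)
      = - (a * q * (b * x - c) / x ^ 2) * (f * (1 - x * Q) * (1 - x * (q * Q)))"
    by (simp add: Bcoef_def field_simps) (algebra)
  moreover have "qpoch (x / q) q (Suc k) = (1 - x / q) * f"
    using q by (simp add: qpoch_Suc_shift f_def)
  ultimately have "Yop q a b c (\<lambda>x. qpoch x q (Suc k)) x
      = - (a * q * (b * x - c) / x ^ 2) * (f * (1 - x * Q) * (1 - x * (q * Q)))
        + Dcoef q a c x * ((1 - x / q) * f)
        - (Bcoef q a b c x + Dcoef q a c x) * (f * (1 - x * Q))"
    by (simp add: Yop_def Tplus_def Tminus_def f1)
  also have "\<dots> = (1 - q * Q) * (1 - a * b * (q * (q * Q))) / (q * Q) * (f * (1 - x * Q))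
      - (1 - q * Q) * (1 - a * (q * Q)) * (1 - c * (q * Q)) / (q * Q) * f"
    using q x Q unfolding Bcoef_def Dcoef_def
    by (simp add: divide_simps) algebra
  finally show ?thesis
    unfolding eigval_of_nat[OF q] f1 by (simp add: f_def Q_def)
qed

definition phi_coeff :: "complex \<Rightarrow> complex \<Rightarrow> complex \<Rightarrow> complex \<Rightarrow> nat \<Rightarrow> nat \<Rightarrow> complex" where
  "phi_coeff q a b c n k = qpoch (q powi (- int n)) q k * qpoch (a * b * q ^ (n + 1)) q k /
     (qpoch (a * q) q k * qpoch (c * q) q k * qpoch q q k) * q ^ k"

text \<open>
  Both sides reduce to the factorization
  \<open>\<lambda> k - \<lambda> n = q^(-k) (1 - q^(k-n)) (1 - a b q^(n+k+1))\<close>, whose last two factors are the ones that the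
  numerator of the hypergeometric coefficient gains from \<open>k\<close> to \<open>k + 1\<close>.
\<close>
lemma phi_coeff_Suc:
  assumes q: "q \<noteq> 0" and q1: "\<forall>k\<ge>1. q ^ k \<noteq> 1"
    and a: "\<forall>k\<ge>1. a * q ^ k \<noteq> 1" and c: "\<forall>k\<ge>1. c * q ^ k \<noteq> 1"
  shows "phi_coeff q a b c n (Suc k)
      * ((1 - q ^ Suc k) * (1 - a * q ^ Suc k) * (1 - c * q ^ Suc k) / q ^ Suc k)
    = phi_coeff q a b c n k * (eigval q a b (int k) - eigval q a b (int n))"
proof -
  define Q where "Q = q ^ k"
  define N where "N = q ^ n"
  have QN: "Q \<noteq> 0" "N \<noteq> 0" using q by (auto simp: Q_def N_def)
  have nz: "1 - q * Q \<noteq> 0" "1 - a * (q * Q) \<noteq> 0" "1 - c * (q * Q) \<noteq> 0"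
    using q1[rule_format, of "Suc k"] a[rule_format, of "Suc k"] c[rule_format, of "Suc k"]
    by (auto simp: Q_def)
  define t where "t = phi_coeff q a b c n k"
  have "phi_coeff q a b c n (Suc k) = t * (q * (1 - Q / N) * (1 - a * b * (q * N) * Q)
      / ((1 - a * q * Q) * (1 - c * q * Q) * (1 - q * Q)))"
    by (simp add: phi_coeff_def t_def qpoch_Suc Q_def N_def power_int_minus field_simps)
  also have "\<dots> * ((1 - q * Q) * (1 - a * (q * Q)) * (1 - c * (q * Q)) / (q * Q))
      = t * ((1 - Q / N) * (1 - a * b * (q * N) * Q) / Q)"
    using nz q QN by (simp add: mult.assoc)
  also have "(1 - Q / N) * (1 - a * b * (q * N) * Q) / Q
      = (1 - Q) * (1 - a * b * (q * Q)) / Q - (1 - N) * (1 - a * b * (q * N)) / N"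
    using QN by (simp add: field_simps)
  finally show ?thesis
    unfolding eigval_of_nat[OF q] by (simp add: t_def Q_def N_def)
qed

text \<open>
  In the partial sum up to \<open>m\<close> the two contributions to each \<open>(x;q)_k\<close> with \<open>k < m\<close> cancel, and
  only the diagonal one to \<open>(x;q)_m\<close> is left.
\<close>
lemma Yop_partial_sum:
  assumes q: "q \<noteq> 0" and q1: "\<forall>k\<ge>1. q ^ k \<noteq> 1"
    and a: "\<forall>k\<ge>1. a * q ^ k \<noteq> 1" and c: "\<forall>k\<ge>1. c * q ^ k \<noteq> 1"
    and x: "x \<noteq> 0"
  shows "Yop q a b c (\<lambda>x. \<Sum>k\<le>m. phi_coeff q a b c n k * qpoch x q k) x
    = eigval q a b (int n) * (\<Sum>k\<le>m. phi_coeff q a b c n k * qpoch x q k)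
      + phi_coeff q a b c n m * (eigval q a b (int m) - eigval q a b (int n)) * qpoch x q m"
proof (induction m)
  case 0
  show ?case by (simp add: Yop_const eigval_def)
next
  case (Suc m)
  let ?t = "phi_coeff q a b c n" and ?l = "\<lambda>k. eigval q a b (int k)"
  let ?\<mu> = "(1 - q ^ Suc m) * (1 - a * q ^ Suc m) * (1 - c * q ^ Suc m) / q ^ Suc m"
  have "Yop q a b c (\<lambda>x. \<Sum>k\<le>Suc m. ?t k * qpoch x q k) x
      = Yop q a b c (\<lambda>x. \<Sum>k\<le>m. ?t k * qpoch x q k) x
        + ?t (Suc m) * Yop q a b c (\<lambda>x. qpoch x q (Suc m)) x"
    by (simp only: sum.atMost_Suc Yop_add Yop_cmult)
  also have "\<dots> = ?l n * (\<Sum>k\<le>m. ?t k * qpoch x q k) + ?t m * (?l m - ?l n) * qpoch x q m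
      + ?t (Suc m) * (?l (Suc m) * qpoch x q (Suc m) - ?\<mu> * qpoch x q m)"
    by (simp only: Suc.IH Yop_qpoch_Suc[OF q x])
  also have "\<dots> = ?l n * (\<Sum>k\<le>m. ?t k * qpoch x q k) + ?t m * (?l m - ?l n) * qpoch x q m
      + ?t (Suc m) * ?l (Suc m) * qpoch x q (Suc m) - (?t (Suc m) * ?\<mu>) * qpoch x q m"
    by (simp only: right_diff_distrib mult.assoc add_diff_eq)
  also have "\<dots> = ?l n * (\<Sum>k\<le>m. ?t k * qpoch x q k)
      + ?t (Suc m) * ?l (Suc m) * qpoch x q (Suc m)"
    unfolding phi_coeff_Suc[OF q q1 a c] by simp
  also have "\<dots> = ?l n * (\<Sum>k\<le>Suc m. ?t k * qpoch x q k)
      + ?t (Suc m) * (?l (Suc m) - ?l n) * qpoch x q (Suc m)"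
    by (simp only: sum.atMost_Suc) (simp only: algebra_simps)
  finally show ?case .
qed

theorem Yop_bqJacobi:
  assumes "q \<noteq> 0" and "\<forall>k\<ge>1. q ^ k \<noteq> 1"
    and "\<forall>k\<ge>1. a * q ^ k \<noteq> 1" and "\<forall>k\<ge>1. c * q ^ k \<noteq> 1" and "x \<noteq> 0"
  shows "Yop q a b c (poly (bqJacobi q a b c n)) x
    = eigval q a b (int n) * poly (bqJacobi q a b c n) x"
proof -
  define s where "s = inverse (lead_coeff (Phi32 q a b c n))"
  have P: "poly (bqJacobi q a b c n) = (\<lambda>x. s * (\<Sum>k\<le>n. phi_coeff q a b c n k * qpoch x q k))"
    by (simp add: fun_eq_iff bqJacobi_def s_def Phi32_def phi_coeff_def poly_sum poly_qpoch_X
        atLeast0AtMost)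
  show ?thesis
    unfolding P Yop_cmult Yop_partial_sum[OF assms] by simp
qed

theorem mainTheorem4:
  fixes q a b c \<tau>0 \<tau>1 \<tau>2 \<tau>3 \<tau>4 :: complex
    and \<beta> u \<xi> \<eta> \<zeta> :: "nat \<Rightarrow> complex"
    and P :: "nat \<Rightarrow> complex poly" and lam :: "int \<Rightarrow> complex"
  defines "P \<equiv> bqJacobi q a b c"
    and "lam \<equiv> eigval q a b"
    and "\<xi> \<equiv> \<lambda>n. \<tau>1 * lam (int n - 1) + \<tau>2 * lam (int n) + \<tau>3"
    and "\<zeta> \<equiv> \<lambda>n. \<tau>2 * lam (int n - 1) + \<tau>1 * lam (int n) + \<tau>3"
    and "\<eta> \<equiv> \<lambda>n. (\<tau>1 + \<tau>2) * lam (int n) * \<beta> n + \<tau>3 * \<beta> n + \<tau>4 * lam (int n) + \<tau>0"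
  assumes "q \<noteq> 0" and "\<forall>k\<ge>1. q ^ k \<noteq> 1"
    and "\<forall>k\<ge>1. a * q ^ k \<noteq> 1"
    and "\<forall>k\<ge>1. c * q ^ k \<noteq> 1"
    and "\<forall>k\<ge>1. a * b * q ^ k \<noteq> 1"
    and "\<forall>n. [:0, 1:] * P n = P (n + 1) + smult (\<beta> n) (P n)
               + smult (u n) (case n of 0 \<Rightarrow> 0 | Suc m \<Rightarrow> P m)"
    and "u 0 = 0"
  shows "\<forall>n. \<forall>x. x \<noteq> 0 \<longrightarrow>
           qHeun q a b c \<tau>0 \<tau>1 \<tau>2 \<tau>3 \<tau>4 (poly (P n)) x
           = \<xi> (n + 1) * poly (P (n + 1)) x + \<eta> n * poly (P n) x
             + \<zeta> n * u n * poly (case n of 0 \<Rightarrow> 0 | Suc m \<Rightarrow> P m) x"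
proof (intro allI impI)
  fix n :: nat and x :: complex
  assume x: "x \<noteq> 0"
  (* For n = 0 the predecessor is the zero polynomial, an eigenfunction for any eigenvalue
     and in particular for the one at index -1. *)
  define R where "R = (case n of 0 \<Rightarrow> 0 | Suc m \<Rightarrow> P m)"
  have Y: "Yop q a b c (poly (P k)) x = lam (int k) * poly (P k) x" for k
    unfolding P_def lam_def using assms(6-9) x by (rule Yop_bqJacobi)
  have YR: "Yop q a b c (poly R) x = lam (int n - 1) * poly R x"
  proof (cases n)
    case 0
    then have "poly R = (\<lambda>y. 0)" by (simp add: R_def fun_eq_iff)
    then show ?thesis by (simp add: Yop_const)
  next
    case (Suc m)
    then show ?thesis by (simp add: R_def Y)
  qed
  have rec: "poly ([:0, 1:] * P n) y
      = poly (P (n + 1)) y + \<beta> n * poly (P n) y + u n * poly R y" for y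
    using assms(11) by (simp only: R_def poly_add poly_smult)
  then have X: "Xop (poly (P n)) = (\<lambda>y. poly (P (n + 1)) y + \<beta> n * poly (P n) y + u n * poly R y)"
    by (simp add: Xop_def fun_eq_iff)
  have YX: "Yop q a b c (Xop (poly (P n))) x = lam (int n + 1) * poly (P (n + 1)) x
      + \<beta> n * (lam (int n) * poly (P n) x) + u n * (lam (int n - 1) * poly R x)"
    unfolding X Yop_add Yop_cmult Y YR by (simp add: add.commute)
  have XY: "Xop (Yop q a b c (poly (P n))) x = lam (int n) * Xop (poly (P n)) x"
    by (simp add: Xop_def Y)
  show "qHeun q a b c \<tau>0 \<tau>1 \<tau>2 \<tau>3 \<tau>4 (poly (P n)) x
      = \<xi> (n + 1) * poly (P (n + 1)) x + \<eta> n * poly (P n) x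
        + \<zeta> n * u n * poly (case n of 0 \<Rightarrow> 0 | Suc m \<Rightarrow> P m) x"
    unfolding qHeun_def XY YX unfolding Y X R_def[symmetric] \<xi>_def \<eta>_def \<zeta>_def
    by (simp add: algebra_simps)
qed

end
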